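(* Let $K$ be a field, $d,n>1$ and $e\ge 1$ integers, $N=\binom{d+n-1}{d}$, and $v_d\colon K^n\to K^N$ the Veronese map. Let $\mathcal U$ be an $(e+1)$-independent set of at least $de+1$ nonzero subspaces of $K^n$. Then the set $v_d(\mathcal U)=\{\langle v_d(U)\rangle\mid U\in\mathcal U\}$ is a $(de+1)$-independent set of subspaces of $K^N$; that is, for any $de+1$ distinct members $U_0,\dots,U_{de}$ of $\mathcal U$, the sum $\sum_{i=0}^{de}\langle v_d(U_i)\rangle$ is a direct sum.
   Context: Fix an arbitrary ordering of all sequences $\alpha=(a_1,\dots,a_n)$ of nonnegative integers with $\sum_k a_k=d$; the coordinates of $K^N$ are indexed by them. For $t\in K^n$ put $t^\alpha=\prod_i t_i^{a_i}$ and $v_d(t)=(t^\alpha)_\alpha$. For a subspace $U$ of $K^n$, $v_d(U)=\{v_d(u)\mid u\in U\}$ and $\langle v_d(U)\rangle$ is its linear span. A set of at least $k$ subspaces is called $k$-independent if the subspace spanned by any $k$ distinct members of it is their direct sum. *)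

theory Defs
  imports "HOL-Analysis.Cartesian_Space" "HOL-Library.FuncSet"
begin

text \<open>An arbitrary ordering of the exponent sequences of weight \<open>d\<close>: it names the
  \<open>j\<close>-th coordinate of \<open>K\<^sup>N\<close> by the sequence \<open>\<alpha> j\<close>. Bijectivity already forces
  \<open>CARD('N) = (d + CARD('n) - 1) choose d\<close>.\<close>

definition exponent_ordering :: "nat \<Rightarrow> ('N::finite \<Rightarrow> 'n::finite \<Rightarrow> nat) \<Rightarrow> bool" where
  "exponent_ordering d \<alpha> \<longleftrightarrow> bij_betw \<alpha> UNIV {a. (\<Sum>k\<in>UNIV. a k) = d}"

text \<open>The degree \<open>d\<close> enters through the ordering \<open>\<alpha>\<close>.\<close>

definition veronese :: "('N::finite \<Rightarrow> 'n::finite \<Rightarrow> nat) \<Rightarrow> 'k::field ^ 'n \<Rightarrow> 'k ^ 'N" where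
  "veronese \<alpha> t = (\<chi> j. \<Prod>i\<in>UNIV. (t $ i) ^ (\<alpha> j i))"

text \<open>Internal direct sum of a family of subspaces. The family is indexed, so equal
  summands at different indices are not identified.\<close>

definition span_is_direct_sum :: "'i set \<Rightarrow> ('i \<Rightarrow> ('k::field ^ 'm::finite) set) \<Rightarrow> bool" where
  "span_is_direct_sum I W \<longleftrightarrow>
     (\<forall>v \<in> vec.span (\<Union>i\<in>I. W i). \<exists>!w. w \<in> Pi\<^sub>E I W \<and> v = (\<Sum>i\<in>I. w i))"

text \<open>The set of subspaces may be infinite, and \<open>card\<close> of an infinite set is \<open>0\<close>.\<close>

definition at_least :: "nat \<Rightarrow> 'a set \<Rightarrow> bool" where
  "at_least k S \<longleftrightarrow> infinite S \<or> k \<le> card S"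

definition k_independent :: "nat \<Rightarrow> ('k::field ^ 'm::finite) set set \<Rightarrow> bool" where
  "k_independent k \<U> \<longleftrightarrow>
     (\<forall>U\<in>\<U>. vec.subspace U) \<and> at_least k \<U> \<and>
     (\<forall>W. inj_on W {..<k} \<and> W ` {..<k} \<subseteq> \<U> \<longrightarrow> span_is_direct_sum {..<k} W)"

end

theory Submission
  imports Defs "HOL-Library.Multiset"
begin

text \<open>If \<open>\<Sum>\<^sub>i w\<^sub>i = 0\<close> with \<open>w\<^sub>i\<close> in the span of \<open>v\<^sub>d(U\<^sub>i)\<close>, split the \<open>d e\<close> indices other
  than a given \<open>i\<^sub>0\<close> into \<open>d\<close> blocks of size \<open>e\<close>. Since the \<open>e + 1\<close> subspaces consisting of
  \<open>U\<^sub>i\<^sub>0\<close> and those of one block are independent, any linear form on \<open>U\<^sub>i\<^sub>0\<close> extends to a linear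
  form vanishing on that block. A product of \<open>d\<close> such extensions, one for each block, is a
  linear functional of \<open>v\<^sub>d(t)\<close> which kills every \<open>w\<^sub>i\<close> with \<open>i \<noteq> i\<^sub>0\<close> and hence \<open>w\<^sub>i\<^sub>0\<close>. Since each
  monomial of degree \<open>d\<close> is a product of \<open>d\<close> coordinate forms, all coordinates of
  \<open>w\<^sub>i\<^sub>0\<close> vanish.\<close>

section \<open>Independent families of subspaces\<close>

text \<open>Uniqueness of the decomposition of 0 alone, with no condition on \<open>w\<close>
  outside \<open>I\<close>. This form is convenient for exhibiting and refuting linear
  relations.\<close>

definition independent_family :: "'i set \<Rightarrow> ('i \<Rightarrow> ('k::field ^ 'm::finite) set) \<Rightarrow> bool" where
  "independent_family I W \<longleftrightarrow>
     (\<forall>w. (\<forall>i\<in>I. w i \<in> W i) \<and> (\<Sum>i\<in>I. w i) = 0 \<longrightarrow> (\<forall>i\<in>I. w i = 0))"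

lemma span_UN_imp_sum:
  fixes W :: "'i \<Rightarrow> ('k::field ^ 'm::finite) set"
  assumes "finite I" and "\<And>i. i \<in> I \<Longrightarrow> vec.subspace (W i)"
    and "v \<in> vec.span (\<Union>i\<in>I. W i)"
  shows "\<exists>w. (\<forall>i\<in>I. w i \<in> W i) \<and> v = (\<Sum>i\<in>I. w i)"
  using assms
proof (induction arbitrary: v rule: finite_induct)
  case empty
  then show ?case by simp
next
  case (insert j F)
  have "v \<in> vec.span (W j \<union> (\<Union>i\<in>F. W i))"
    using insert.prems(2) by simp
  then obtain x y where x: "x \<in> vec.span (W j)" and y: "y \<in> vec.span (\<Union>i\<in>F. W i)"
    and v: "v = x + y"
    unfolding vec.span_Un by blast
  have x': "x \<in> W j"
    using x vec.span_eq_iff[THEN iffD2, OF insert.prems(1)[of j]] by simp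
  obtain w where w: "\<forall>i\<in>F. w i \<in> W i" "y = (\<Sum>i\<in>F. w i)"
    using insert.IH[OF _ y] insert.prems(1) by blast
  have "(\<Sum>i\<in>F. (w(j := x)) i) = (\<Sum>i\<in>F. w i)"
    using insert.hyps by (intro sum.cong) auto
  then have "v = (\<Sum>i\<in>insert j F. (w(j := x)) i)"
    using insert.hyps v w(2) by simp
  moreover have "\<forall>i\<in>insert j F. (w(j := x)) i \<in> W i"
    using w(1) x' insert.hyps by auto
  ultimately show ?case by blast
qed

text \<open>Two decompositions of the same vector differ by a decomposition of 0, so uniqueness at 0
  gives uniqueness everywhere; existence is \<open>span_UN_imp_sum\<close>.\<close>

lemma span_is_direct_sum_iff:
  fixes W :: "'i \<Rightarrow> ('k::field ^ 'm::finite) set"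
  assumes fin: "finite I" and sub: "\<And>i. i \<in> I \<Longrightarrow> vec.subspace (W i)"
  shows "span_is_direct_sum I W \<longleftrightarrow> independent_family I W"
proof
  assume ds: "span_is_direct_sum I W"
  have uniq: "\<exists>!w. w \<in> Pi\<^sub>E I W \<and> 0 = (\<Sum>i\<in>I. w i)"
    using ds vec.span_zero unfolding span_is_direct_sum_def by blast
  show "independent_family I W"
    unfolding independent_family_def
  proof (intro allI impI ballI)
    fix w i assume w: "(\<forall>i\<in>I. w i \<in> W i) \<and> (\<Sum>i\<in>I. w i) = 0" and i: "i \<in> I"
    have "restrict w I \<in> Pi\<^sub>E I W \<and> 0 = (\<Sum>i\<in>I. restrict w I i)"
      using w by auto
    moreover have "(\<lambda>i\<in>I. 0) \<in> Pi\<^sub>E I W \<and> 0 = (\<Sum>j\<in>I. (\<lambda>i\<in>I. 0 :: 'k ^ 'm) j)"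
      using sub vec.subspace_0 by auto
    ultimately have "restrict w I = (\<lambda>i\<in>I. 0)"
      using uniq by blast
    then show "w i = 0"
      using i by (metis restrict_apply')
  qed
next
  assume ind: "independent_family I W"
  show "span_is_direct_sum I W"
    unfolding span_is_direct_sum_def
  proof (intro ballI ex_ex1I)
    fix v assume "v \<in> vec.span (\<Union>i\<in>I. W i)"
    from span_UN_imp_sum[OF fin sub this] obtain w
      where w: "\<forall>i\<in>I. w i \<in> W i" "v = (\<Sum>i\<in>I. w i)" by blast
    have "restrict w I \<in> Pi\<^sub>E I W \<and> v = (\<Sum>i\<in>I. restrict w I i)"
      using w by auto
    then show "\<exists>w. w \<in> Pi\<^sub>E I W \<and> v = (\<Sum>i\<in>I. w i)" by blast
  next
    fix v w w'
    assume w: "w \<in> Pi\<^sub>E I W \<and> v = (\<Sum>i\<in>I. w i)"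
      and w': "w' \<in> Pi\<^sub>E I W \<and> v = (\<Sum>i\<in>I. w' i)"
    have "\<forall>i\<in>I. w i - w' i \<in> W i"
      using w w' sub vec.subspace_diff by (meson PiE_mem)
    moreover have "(\<Sum>i\<in>I. w i - w' i) = 0"
      using w w' by (simp add: sum_subtractf)
    ultimately have "\<forall>i\<in>I. w i - w' i = 0"
      using ind[unfolded independent_family_def, THEN spec, of "\<lambda>i. w i - w' i"] by blast
    then show "w = w'"
      using w w' by (intro PiE_ext[of w I W w']) auto
  qed
qed

lemma independent_family_reindex:
  assumes "bij_betw h A I" and "independent_family A (W \<circ> h)"
  shows "independent_family I W"
  unfolding independent_family_def
proof (intro allI impI ballI)
  fix w i assume w: "(\<forall>i\<in>I. w i \<in> W i) \<and> (\<Sum>i\<in>I. w i) = 0" and i: "i \<in> I"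
  have "\<forall>a\<in>A. w (h a) \<in> (W \<circ> h) a"
    using w assms(1) by (auto simp: bij_betw_def)
  moreover have "(\<Sum>a\<in>A. w (h a)) = 0"
    using sum.reindex_bij_betw[OF assms(1), of w] w by simp
  ultimately have "\<forall>a\<in>A. w (h a) = 0"
    using assms(2)[unfolded independent_family_def, rule_format, of "\<lambda>a. w (h a)"] by blast
  then show "w i = 0"
    using i assms(1) by (auto simp: bij_betw_def)
qed

text \<open>A common vector \<open>x\<close> is a sum of vectors from the \<open>W i\<close> with
  \<open>i\<close> in \<open>B\<close>; putting \<open>- x\<close> at index \<open>j\<close> turns
  this into a relation, which must be trivial.\<close>

lemma independent_family_Int_span:
  assumes fin: "finite B" and j: "j \<notin> B"
    and sub: "\<And>i. i \<in> insert j B \<Longrightarrow> vec.subspace (W i)"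
    and ind: "independent_family (insert j B) W"
  shows "W j \<inter> vec.span (\<Union>i\<in>B. W i) \<subseteq> {0}"
proof
  fix x assume x: "x \<in> W j \<inter> vec.span (\<Union>i\<in>B. W i)"
  then obtain w where w: "\<forall>i\<in>B. w i \<in> W i" "x = (\<Sum>i\<in>B. w i)"
    using span_UN_imp_sum[OF fin, of W x] sub by blast
  have "- x \<in> W j"
    using x sub vec.subspace_neg by blast
  then have "\<forall>i\<in>insert j B. (w(j := - x)) i \<in> W i"
    using w(1) j by auto
  moreover have "(\<Sum>i\<in>B. (w(j := - x)) i) = (\<Sum>i\<in>B. w i)"
    using j by (intro sum.cong) auto
  then have "(\<Sum>i\<in>insert j B. (w(j := - x)) i) = 0"
    using fin j w(2) by simp
  ultimately have "(w(j := - x)) j = 0"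
    using ind unfolding independent_family_def by blast
  then show "x \<in> {0}" by simp
qed

lemma subspace_sum_scale:
  "vec.subspace V \<Longrightarrow> B \<subseteq> V \<Longrightarrow> (\<Sum>b\<in>B. f b *s b) \<in> V"
  by (intro vec.subspace_sum vec.subspace_scale) auto

text \<open>Bases of \<open>U\<close> and \<open>S\<close> together stay independent, so a linear
  map may be prescribed on them. The coordinates of \<open>p\<close> extend all coordinate forms on
  \<open>U\<close> at once by forms vanishing on \<open>S\<close>.\<close>

lemma exists_linear_projection:
  fixes U S :: "('k::field ^ 'n::finite) set"
  assumes U: "vec.subspace U" and S: "vec.subspace S" and US: "U \<inter> S \<subseteq> {0}"
  shows "\<exists>p. Vector_Spaces.linear (*s) (*s) p \<and> (\<forall>u\<in>U. p u = u) \<and> (\<forall>s\<in>S. p s = 0)"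
proof -
  obtain B where B: "B \<subseteq> U" "vec.independent B" "U \<subseteq> vec.span B"
    using vec.maximal_independent_subset by blast
  obtain C where C: "C \<subseteq> S" "vec.independent C" "S \<subseteq> vec.span C"
    using vec.maximal_independent_subset by blast
  have finB: "finite B" and finC: "finite C"
    using B C vec.finiteI_independent by blast+
  \<comment> \<open>The bases could meet only in 0, which a basis does not contain.\<close>
  have "0 \<notin> B" using B(2) vec.dependent_zero by blast
  then have disj: "B \<inter> C = {}" using B(1) C(1) US by blast
  have ind: "vec.independent (B \<union> C)"
  proof (rule vec.independent_if_scalars_zero)
    fix f x
    assume sum0: "(\<Sum>x\<in>B \<union> C. f x *s x) = 0" and x: "x \<in> B \<union> C"
    have s: "(\<Sum>x\<in>B. f x *s x) = - (\<Sum>x\<in>C. f x *s x)"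
      using sum0 sum.union_disjoint[OF finB finC disj, of "\<lambda>x. f x *s x"]
      by (simp add: eq_neg_iff_add_eq_0)
    have inU: "(\<Sum>x\<in>B. f x *s x) \<in> U"
      using subspace_sum_scale[OF U B(1)] .
    have "(\<Sum>x\<in>C. f x *s x) \<in> S"
      using subspace_sum_scale[OF S C(1)] .
    then have B0: "(\<Sum>x\<in>B. f x *s x) = 0"
      using inU US vec.subspace_neg[OF S] unfolding s by blast
    then have C0: "(\<Sum>x\<in>C. f x *s x) = 0" using s by simp
    show "f x = 0"
      using x B0 C0 vec.independentD[OF B(2) finB] vec.independentD[OF C(2) finC] by blast
  qed (use finB finC in simp)
  define g where "g = (\<lambda>b. if b \<in> B then b else 0)"
  obtain p where p: "Vector_Spaces.linear (*s) (*s) p" "\<forall>x\<in>B \<union> C. p x = g x"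
    using vec.linear_independent_extend[OF ind] by blast
  have "p u = u" if "u \<in> U" for u
    using vec.linear_eq_on[OF p(1) vec.linear_ident, of u B] that B(3) p(2)
    by (auto simp: g_def)
  moreover have "p s = 0" if "s \<in> S" for s
    proof (rule vec.linear_eq_on[OF p(1) vec.linear_zero])
    show "s \<in> vec.span C" using that C(3) by blast
    show "p b = 0" if "b \<in> C" for b using that p(2) disj by (auto simp: g_def)
  qed
  ultimately show ?thesis using p(1) by blast
qed

section \<open>Linear functionals on the Veronese image\<close>

text \<open>Grouping the factors by the value of \<open>s\<close> turns a word of length
  \<open>d\<close> in the coordinates into an exponent sequence.\<close>

lemma prod_eq_prod_power_card:
  fixes x :: "'n::finite \<Rightarrow> 'k::comm_monoid_mult" and d :: nat
  shows "(\<Prod>j<d. x (s j)) = (\<Prod>i\<in>UNIV. x i ^ card {j\<in>{..<d}. s j = i})"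
proof -
  have "(\<Prod>i\<in>UNIV. x i ^ card {j\<in>{..<d}. s j = i}) = (\<Prod>i\<in>UNIV. \<Prod>j\<in>{j\<in>{..<d}. s j = i}. x (s j))"
    by (intro prod.cong) auto
  also have "\<dots> = (\<Prod>j<d. x (s j))"
    by (rule prod.group) auto
  finally show ?thesis ..
qed

text \<open>The letter counts of the word \<open>s\<close> add up to \<open>d\<close>, so they form
  one of the sequences listed by \<alpha>.\<close>

lemma exponent_ordering_surj:
  fixes \<alpha> :: "'N::finite \<Rightarrow> 'n::finite \<Rightarrow> nat"
  assumes "exponent_ordering d \<alpha>"
  shows "\<exists>J. \<forall>u :: 'k::field ^ 'n. veronese \<alpha> u $ J = (\<Prod>j<d. u $ s j)"
proof -
  have "(\<Sum>i\<in>UNIV. card {j\<in>{..<d}. s j = i}) = card {..<d}"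
    using sum.group[of "{..<d}" UNIV s "\<lambda>_. 1 :: nat"] by simp
  then have "(\<lambda>i. card {j\<in>{..<d}. s j = i}) \<in> range \<alpha>"
    using assms by (auto simp: exponent_ordering_def bij_betw_def)
  then obtain J where "\<alpha> J = (\<lambda>i. card {j\<in>{..<d}. s j = i})" by auto
  then have "veronese \<alpha> u $ J = (\<Prod>j<d. u $ s j)" for u :: "'k ^ 'n"
    by (simp add: veronese_def prod_eq_prod_power_card[of "\<lambda>i. u $ i"])
  then show ?thesis by blast
qed

text \<open>Conversely, any list containing each \<open>i\<close> exactly
  \<open>\<alpha> J i\<close> times has length \<open>d\<close> and serves as the word
  \<open>s\<close>.\<close>

lemma veronese_coordinate_eq_prod:
  fixes \<alpha> :: "'N::finite \<Rightarrow> 'n::finite \<Rightarrow> nat"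
  assumes "exponent_ordering d \<alpha>"
  shows "\<exists>s. \<forall>u :: 'k::field ^ 'n. veronese \<alpha> u $ J = (\<Prod>j<d. u $ s j)"
proof -
  have deg: "(\<Sum>i\<in>UNIV. \<alpha> J i) = d"
    using assms by (auto simp: exponent_ordering_def bij_betw_def)
  obtain xs where xs: "mset xs = (\<Sum>i\<in>UNIV. replicate_mset (\<alpha> J i) i)"
    using ex_mset by blast
  have "length xs = d"
    using deg by (simp flip: size_mset add: xs)
  moreover have "count (mset xs) i = \<alpha> J i" for i
    by (simp add: xs count_sum)
  ultimately have "card {j\<in>{..<d}. xs ! j = i} = \<alpha> J i" for i
    by (simp add: count_mset count_list_eq_length_filter length_filter_conv_card eq_commute)
  then have "\<forall>u :: 'k ^ 'n. veronese \<alpha> u $ J = (\<Prod>j<d. u $ (xs ! j))"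
    by (simp add: veronese_def prod_eq_prod_power_card[of "\<lambda>i. _ $ i"])
  then show ?thesis by blast
qed

text \<open>Distributivity expands the product into a sum over words \<open>s\<close>, and the
  monomial of each word is a Veronese coordinate. Replacing that monomial by the coordinate
  \<open>J s\<close> makes the expression linear.\<close>

lemma prod_linear_forms_factors_through_veronese:
  fixes \<alpha> :: "'N::finite \<Rightarrow> 'n::finite \<Rightarrow> nat" and g :: "nat \<Rightarrow> 'n \<Rightarrow> 'k::field"
  assumes "exponent_ordering d \<alpha>"
  shows "\<exists>\<phi>. Vector_Spaces.linear (*s) (*) \<phi> \<and>
    (\<forall>u. \<phi> (veronese \<alpha> u) = (\<Prod>j<d. \<Sum>i\<in>UNIV. g j i * u $ i))"
proof -
  define J where "J s = (SOME J. \<forall>u :: 'k ^ 'n. veronese \<alpha> u $ J = (\<Prod>j<d. u $ s j))" for s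
  have J: "veronese \<alpha> u $ J s = (\<Prod>j<d. u $ s j)" for s and u :: "'k ^ 'n"
    using someI_ex[OF exponent_ordering_surj[OF assms, where s = s]] unfolding J_def by blast
  define \<phi> where
    "\<phi> w = (\<Sum>s\<in>{..<d} \<rightarrow>\<^sub>E UNIV. (\<Prod>j<d. g j (s j)) * w $ J s)" for w :: "'k ^ 'N"
  have "Vector_Spaces.linear (*s) (*) \<phi>"
    by unfold_locales
      (simp_all add: \<phi>_def sum.distrib sum_distrib_left algebra_simps)
  moreover have "\<phi> (veronese \<alpha> u) = (\<Prod>j<d. \<Sum>i\<in>UNIV. g j i * u $ i)" for u
    unfolding \<phi>_def J by (subst prod_sum_PiE) (simp_all add: prod.distrib)
  ultimately show ?thesis by blast
qed

lemma linear_eq_sum_axis: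
  fixes p :: "'k::field ^ 'n::finite \<Rightarrow> 'k ^ 'n"
  assumes "Vector_Spaces.linear (*s) (*s) p"
  shows "p u $ s = (\<Sum>i\<in>UNIV. matrix p $ s $ i * u $ i)"
  by (simp add: matrix_vector_mult_def flip: matrix_works[OF assms])

lemma veronese_neq_0:
  assumes "exponent_ordering d \<alpha>" and "u \<noteq> 0"
  shows "veronese \<alpha> u \<noteq> 0"
proof -
  obtain i where i: "u $ i \<noteq> 0"
    using assms(2) by (metis vec_eq_iff zero_index)
  obtain J where "veronese \<alpha> u $ J = (\<Prod>j<d. u $ i)"
    using exponent_ordering_surj[OF assms(1), of "\<lambda>_. i"] by blast
  then show ?thesis using i by auto
qed

text \<open>The index type is arbitrary, so that families numbered by integers and sets of subspaces
  indexed by themselves are both covered.\<close>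

lemma independent_family_veronese:
  fixes \<alpha> :: "'N::finite \<Rightarrow> 'n::finite \<Rightarrow> nat" and U :: "'i \<Rightarrow> ('k::field ^ 'n) set"
  assumes \<alpha>: "exponent_ordering d \<alpha>"
    and card: "card I = d * e + 1"
    and sub: "\<And>i. i \<in> I \<Longrightarrow> vec.subspace (U i)"
    and ind: "\<And>A. A \<subseteq> I \<Longrightarrow> card A = e + 1 \<Longrightarrow> independent_family A U"
  shows "independent_family I (\<lambda>i. vec.span (veronese \<alpha> ` U i))"
  unfolding independent_family_def
proof (intro allI impI ballI)
  fix w i0
  assume w: "(\<forall>i\<in>I. w i \<in> vec.span (veronese \<alpha> ` U i)) \<and> (\<Sum>i\<in>I. w i) = 0" and i0: "i0 \<in> I"
  have finI: "finite I" using card by (metis Suc_eq_plus1 card.infinite nat.distinct(1))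
  have "card (I - {i0}) = d * e" using card i0 finI by simp
  then obtain h where h: "bij_betw h {..<d * e} (I - {i0})"
    using finI by (metis bij_betw_from_nat_into_finite finite_Diff)
  \<comment> \<open>The blocks are the images under the enumeration \<open>h\<close> of consecutive
    intervals of length \<open>e\<close>.\<close>
  define B where "B j = h ` {j * e..<j * e + e}" for j
  have blk: "{j * e..<j * e + e} \<subseteq> {..<d * e}" if "j < d" for j
  proof -
    have "Suc j * e \<le> d * e" using that by (intro mult_le_mono1) simp
    then show ?thesis by auto
  qed
  have Bsub: "B j \<subseteq> I - {i0}" if "j < d" for j
    using blk[OF that] h unfolding B_def bij_betw_def by blast
  have Bcard: "card (B j) = e" if "j < d" for j
  proof -
    have "inj_on h {j * e..<j * e + e}"
      using h blk[OF that] inj_on_subset unfolding bij_betw_def by blast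
    then show ?thesis by (simp add: B_def card_image)
  qed
  \<comment> \<open>The index numbered \<open>m\<close> lies in block
    \<open>m div e\<close>.\<close>
  have Bcover: "\<exists>j<d. i \<in> B j" if i: "i \<in> I" "i \<noteq> i0" for i
  proof -
    have "i \<in> h ` {..<d * e}" using i bij_betw_imp_surj_on[OF h] by simp
    then obtain m where m: "m < d * e" "i = h m"
      by blast
    then have e: "e > 0" by (cases e) auto
    have "m div e < d" using m(1) by (simp add: less_mult_imp_div_less)
    moreover have "m div e * e \<le> m" "m < m div e * e + e"
      using dividend_less_div_times[OF e, of m] by (simp_all add: add.commute)
    ultimately show ?thesis using m(2) unfolding B_def by (intro exI[of _ "m div e"]) auto
  qed
  \<comment> \<open>For each block, a single map that fixes \<open>U i0\<close> and kills the block
    handles all coordinates together.\<close>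
  have "\<exists>p. Vector_Spaces.linear (*s) (*s) p \<and> (\<forall>u\<in>U i0. p u = u) \<and>
      (\<forall>i\<in>B j. \<forall>u\<in>U i. p u = 0)" if j: "j < d" for j
  proof -
    have fin: "finite (B j)" and n: "i0 \<notin> B j" and I: "insert i0 (B j) \<subseteq> I"
      using Bsub[OF j] finI finite_subset i0 by (auto simp: B_def)
    have "independent_family (insert i0 (B j)) U"
      using ind[OF I] fin n Bcard[OF j] by simp
    then have "U i0 \<inter> vec.span (\<Union>i\<in>B j. U i) \<subseteq> {0}"
      using independent_family_Int_span[OF fin n] sub I by blast
    then obtain p where p: "Vector_Spaces.linear (*s) (*s) p" "\<forall>u\<in>U i0. p u = u"
      "\<forall>s\<in>vec.span (\<Union>i\<in>B j. U i). p s = 0"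
      using exists_linear_projection[OF sub[OF i0] vec.subspace_span] by blast
    have "\<forall>i\<in>B j. \<forall>u\<in>U i. p u = 0"
      using p(3) vec.span_base by blast
    then show ?thesis using p by blast
  qed
  then obtain p where p: "\<And>j. j < d \<Longrightarrow> Vector_Spaces.linear (*s) (*s) (p j)"
    "\<And>j u. j < d \<Longrightarrow> u \<in> U i0 \<Longrightarrow> p j u = u"
    "\<And>j i u. j < d \<Longrightarrow> i \<in> B j \<Longrightarrow> u \<in> U i \<Longrightarrow> p j u = 0"
    by metis
  have "w i0 $ J = 0" for J
  proof -
    \<comment> \<open>The \<open>j\<close>-th letter of a word for the coordinate \<open>J\<close>
      is assigned to block \<open>j\<close>: the \<open>j\<close>-th linear form will be coordinate
      \<open>s j\<close> of \<open>p j\<close>.\<close>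
    obtain s where s: "\<And>u :: 'k ^ 'n. veronese \<alpha> u $ J = (\<Prod>j<d. u $ s j)"
      using veronese_coordinate_eq_prod[OF \<alpha>] by blast
    obtain \<phi> where \<phi>: "Vector_Spaces.linear (*s) (*) \<phi>"
      "\<And>u. \<phi> (veronese \<alpha> u) = (\<Prod>j<d. \<Sum>i\<in>UNIV. matrix (p j) $ s j $ i * u $ i)"
      using prod_linear_forms_factors_through_veronese[OF \<alpha>,
          of "\<lambda>j i. matrix (p j) $ s j $ i"] by blast
    interpret \<phi>: Vector_Spaces.linear "(*s)" "(*)" \<phi> by fact
    have \<phi>': "\<phi> (veronese \<alpha> u) = (\<Prod>j<d. p j u $ s j)" for u
      unfolding \<phi>(2) by (intro prod.cong) (simp_all add: linear_eq_sum_axis[OF p(1)])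
    have other: "\<phi> (w i) = 0" if i: "i \<in> I" "i \<noteq> i0" for i
    proof -
      obtain j where j: "j < d" "i \<in> B j" using Bcover[OF i] by blast
      \<comment> \<open>The factor belonging to the block of \<open>i\<close> vanishes on
        \<open>U i\<close>.\<close>
      have "\<phi> x = 0" if "x \<in> veronese \<alpha> ` U i" for x
        using that j(1) p(3)[OF j] by (auto simp: \<phi>' intro!: bexI[of _ j])
      moreover have "w i \<in> vec.span (veronese \<alpha> ` U i)" using w i by blast
      ultimately show ?thesis by (rule \<phi>.eq_0_on_span)
    qed
    have "0 = \<phi> (\<Sum>i\<in>I. w i)" using w by simp
    also have "\<dots> = (\<Sum>i\<in>I. \<phi> (w i))" by (rule \<phi>.sum)
    also have "\<dots> = \<phi> (w i0)"
      using other finI i0 by (simp add: sum.remove[OF finI i0])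
    finally have 0: "\<phi> (w i0) = 0" ..
    \<comment> \<open>Every \<open>p j\<close> fixes \<open>U i0\<close>, so there
      \<open>\<phi>\<close> reads off the coordinate \<open>J\<close>; agreement on the Veronese
      image passes to its span by linearity of the difference.\<close>
    interpret diff: Vector_Spaces.linear "(*s)" "(*)" "\<lambda>x. \<phi> x - x $ J"
      by unfold_locales (simp_all add: \<phi>.add \<phi>.scale algebra_simps)
    have "\<phi> x - x $ J = 0" if "x \<in> veronese \<alpha> ` U i0" for x
      using that by (auto simp: \<phi>' s p(2))
    moreover have "w i0 \<in> vec.span (veronese \<alpha> ` U i0)" using w i0 by blast
    ultimately have "\<phi> (w i0) - w i0 $ J = 0"
      by (rule diff.eq_0_on_span)
    then show ?thesis using 0 by simp
  qed
  then show "w i0 = 0" by (simp add: vec_eq_iff)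
qed

section \<open>Families of members of an independent set\<close>

text \<open>Enumerating \<open>A\<close> by \<open>{..<k}\<close> passes from the numbered families
  in \<open>k_independent\<close> to any index set of size \<open>k\<close>.\<close>

lemma k_independent_imp_independent_family:
  assumes ind: "k_independent k \<U>" and inj: "inj_on U A" and im: "U ` A \<subseteq> \<U>"
    and card: "card A = k" and fin: "finite A"
  shows "independent_family A U"
proof -
  obtain h where h: "bij_betw h {..<k} A"
    using fin card by (metis card_lessThan finite_lessThan finite_same_card_bij)
  have "inj_on (U \<circ> h) {..<k}" "(U \<circ> h) ` {..<k} \<subseteq> \<U>"
    using h inj im by (auto simp: bij_betw_def intro: comp_inj_on)
  then have "span_is_direct_sum {..<k} (U \<circ> h)" "\<And>i. i \<in> {..<k} \<Longrightarrow> vec.subspace ((U \<circ> h) i)"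
    using ind unfolding k_independent_def by blast+
  then have "independent_family {..<k} (U \<circ> h)"
    using span_is_direct_sum_iff[OF finite_lessThan] by blast
  then show ?thesis using independent_family_reindex[OF h] by blast
qed

text \<open>Serves to complete a pair of members to a family of the size for which independence is
  known.\<close>

lemma at_least_imp_superset:
  assumes "at_least k S" and "finite A" and "A \<subseteq> S" and "card A \<le> k"
  shows "\<exists>T. A \<subseteq> T \<and> T \<subseteq> S \<and> finite T \<and> card T = k"
proof -
  have "\<exists>R. finite R \<and> card R = k - card A \<and> R \<subseteq> S - A"
  proof (cases "finite S")
    case True
    then have "k - card A \<le> card (S - A)"
      using assms by (auto simp: at_least_def card_Diff_subset)
    then show ?thesis by (meson True finite_Diff finite_subset obtain_subset_with_card_n)
  next
    case False
    then have "infinite (S - A)" using assms(2) by simp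
    then show ?thesis using infinite_arbitrarily_large by blast
  qed
  then obtain R where R: "finite R" "card R = k - card A" "R \<subseteq> S - A" by blast
  then have "card (A \<union> R) = k"
    using assms by (subst card_Un_disjoint) auto
  then show ?thesis using R assms by (intro exI[of _ "A \<union> R"]) auto
qed

lemma at_least_image:
  "inj_on f S \<Longrightarrow> at_least k S \<Longrightarrow> at_least k (f ` S)"
  by (auto simp: at_least_def card_image finite_image_iff)

theorem theorem1p2:
  fixes \<alpha> :: "'N::finite \<Rightarrow> 'n::finite \<Rightarrow> nat"
    and \<U> :: "('k::field ^ 'n) set set"
    and d e :: nat
  assumes "d > 1" and "CARD('n) > 1" and "e \<ge> 1"
    and "CARD('N) = (d + CARD('n) - 1) choose d"
    and "exponent_ordering d \<alpha>"
    and "k_independent (e + 1) \<U>"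
    and "at_least (d * e + 1) \<U>"
    and "\<forall>U\<in>\<U>. U \<noteq> {0}"
  shows "k_independent (d * e + 1) ((\<lambda>U. vec.span (veronese \<alpha> ` U)) ` \<U>) \<and>
    (\<forall>U. inj_on U {..d * e} \<and> U ` {..d * e} \<subseteq> \<U> \<longrightarrow>
       span_is_direct_sum {..d * e} (\<lambda>i. vec.span (veronese \<alpha> ` U i)))"
proof -
  let ?F = "\<lambda>U. vec.span (veronese \<alpha> ` U)"
  have sub: "vec.subspace U" if "U \<in> \<U>" for U
    using assms(6) that unfolding k_independent_def by blast
  have main: "independent_family I (\<lambda>i. ?F (U i))"
    if inj: "inj_on U I" and im: "U ` I \<subseteq> \<U>" and card: "card I = d * e + 1"
    for I :: "'i set" and U
  proof (rule independent_family_veronese[OF assms(5) card])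
    show "vec.subspace (U i)" if "i \<in> I" for i using that im sub by blast
    fix A assume A: "A \<subseteq> I" "card A = e + 1"
    then have "finite A" by (metis Suc_eq_plus1 card.infinite nat.distinct(1))
    then show "independent_family A U"
      using k_independent_imp_independent_family[OF assms(6), of U A] A inj im
        inj_on_subset by blast
  qed
  \<comment> \<open>Distinct members must have distinct spans, so that the set of spans still has at
    least \<open>d * e + 1\<close> elements.\<close>
  have inj: "inj_on ?F \<U>"
  proof (rule inj_onI, rule ccontr)
    fix X Y assume XY: "X \<in> \<U>" "Y \<in> \<U>" "?F X = ?F Y" "X \<noteq> Y"
    have "d * e \<ge> 1" using assms(1,3) by simp
    then have "card {X, Y} \<le> d * e + 1" using XY(4) by simp
    then obtain T where T: "{X, Y} \<subseteq> T" "T \<subseteq> \<U>" "finite T" "card T = d * e + 1"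
      using at_least_imp_superset[OF assms(7), of "{X, Y}"] XY by blast
    have fam: "independent_family T ?F"
      using main[of id T] T by simp
    have "0 \<in> X" "X \<noteq> {0}" using XY(1) sub vec.subspace_0 assms(8) by blast+
    then obtain u where u: "u \<in> X" "u \<noteq> 0" by blast
    \<comment> \<open>If the spans of \<open>X\<close> and \<open>Y\<close> coincide, a nonzero
      vector and its negative in these two summands form a nontrivial relation.\<close>
    define w where "w = (\<lambda>Z. if Z = X then veronese \<alpha> u else if Z = Y then - veronese \<alpha> u else 0)"
    have v: "veronese \<alpha> u \<in> ?F X" using u(1) vec.span_base by blast
    then have "\<forall>Z\<in>T. w Z \<in> ?F Z"
      using XY(3) by (auto simp: w_def vec.span_zero intro: vec.span_neg)
    moreover have "(\<Sum>Z\<in>T. w Z) = 0"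
    proof -
      have "(\<Sum>Z\<in>T. w Z) = (\<Sum>Z\<in>{X, Y}. w Z)"
        using T by (intro sum.mono_neutral_right) (auto simp: w_def)
      then show ?thesis using XY(4) by (simp add: w_def)
    qed
    ultimately have "w X = 0"
      using fam T(1) unfolding independent_family_def by blast
    then show False using veronese_neq_0[OF assms(5) u(2)] by (simp add: w_def)
  qed
  have direct: "span_is_direct_sum {..d * e} (\<lambda>i. ?F (U i))"
    if "inj_on U {..d * e}" "U ` {..d * e} \<subseteq> \<U>" for U
    using main[OF that] by (simp add: span_is_direct_sum_iff)
  have "span_is_direct_sum {..<d * e + 1} W"
    if W: "inj_on W {..<d * e + 1}" "W ` {..<d * e + 1} \<subseteq> ?F ` \<U>" for W
  proof -
    \<comment> \<open>Preimages of the \<open>W i\<close> under the span map; they are distinct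
      because the \<open>W i\<close> are.\<close>
    define U where "U = inv_into \<U> ?F \<circ> W"
    have FU: "?F (U i) = W i" if "i < d * e + 1" for i
      using W(2) that f_inv_into_f[of "W i" ?F \<U>] unfolding U_def comp_def by blast
    have "inj_on U {..<d * e + 1}"
      using W(1) FU by (metis (mono_tags, lifting) inj_onD inj_onI lessThan_iff)
    moreover have "U ` {..<d * e + 1} \<subseteq> \<U>"
      using W(2) by (auto simp: U_def intro!: inv_into_into)
    ultimately have "independent_family {..<d * e + 1} (\<lambda>i. ?F (U i))"
      by (intro main) auto
    then have "independent_family {..<d * e + 1} W"
      by (simp add: independent_family_def FU)
    moreover have "vec.subspace (W i)" if "i \<in> {..<d * e + 1}" for i
      using W(2) that by auto
    ultimately show ?thesis
      using span_is_direct_sum_iff[OF finite_lessThan] by blast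
  qed
  then have "k_independent (d * e + 1) (?F ` \<U>)"
    using at_least_image[OF inj assms(7)] by (auto simp: k_independent_def)
  then show ?thesis using direct by blast
qed

end
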